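(* Every relationally complete functional uniform preorder $(I,A,R)$ is induced by an inclusion of typed partial combinatory algebras; that is, there is an inclusion $(I,(\mathcal{A}_{\#,i}\subseteq\mathcal{A}_i)_{i\in I})$ of typed pcas such that $(I,A,R)$ is the uniform preorder $(I,\mathcal{A},R(\mathcal{A}_\#))$ associated to it.
   Context: Relations are composed like functions: if $(x,y)\in r$ and $(y,z)\in s$ then $(x,z)\in sr$. $P$ denotes power set. **Uniform preorders.** A uniform preorder is a triple $(I,A,R)$ with $I$ a set (of sorts), $A=(A_i)_{i\in I}$ a family of sets and $R=(R_{ij})_{i,j\in I}$ with $R_{ij}\subseteq P(A_i\times A_j)$ such that (a) $r\in R_{ij}$, $s\subseteq r$ imply $s\in R_{ij}$; (b) $\mathrm{id}\in R_{ii}$; (c) $r\in R_{ij}$, $s\in R_{jk}$ imply $sr\in R_{ik}$. A monotone map $(I,A,R)\to(J,B,S)$ is a pair $(u:I\to J,(f_i:A_i\to B_{ui})_{i})$ such that $r\in R_{ij}$ implies $\{(f_ia,f_jb)\mid (a,b)\in r\}\in S_{ui,uj}$; order: $(u,f)\le(v,g)$ iff $\{(f_ia,g_ia)\mid a\in A_i\}\in S_{ui,vi}$ for all $i$. It is functional if every $r\in R_{ij}$ is a functional (single-valued, possibly partial) relation. **Finitely complete.** $(I,A,R)$ is finitely complete if the diagonal $\delta:(I,A,R)\to(I,A,R)\times(I,A,R)$ and the terminal projection have right adjoints $( *,\wedge)$ and $(1,\top)$ in the locally ordered category of uniform preorders. Here the product has sorts $I\times I$, underlying sets $A_i\times A_j$,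 and relations all subrelations of $\{((a,b),(a',b'))\mid (a,a')\in r,(b,b')\in s\}$ with $r\in R_{ij}$, $s\in R_{kl}$. Thus one is given $1\in I$, $*:I\times I\to I$, $\top\in A_1$, $\wedge=\wedge_{ij}:A_i\times A_j\to A_{i*j}$ such that $( *,\wedge)$ is monotone, $\{(a\wedge b,a)\}\in R_{i*j,i}$, $\{(a\wedge b,b)\}\in R_{i*j,j}$ (with $a\in A_i,b\in A_j$), $\{(a,a\wedge a)\mid a\in A_i\}\in R_{i,i*i}$, $\{(a,\top)\mid a\in A_i\}\in R_{i,1}$. **Relationally complete.** A finitely complete uniform preorder is relationally complete if for each $j,k\in I$ there are (chosen) $j\Rightarrow k\in I$ and $@^j_k\in R_{(j\Rightarrow k)*j,\,k}$ such that for all $i\in I$ and $r\in R_{i*j,k}$ there exists $\tilde r\in R_{i,\,j\Rightarrow k}$ with $$\forall a\in A_i\ \exists h\in A_{j\Rightarrow k}:\ \tilde r(a,h)\ \text{ and }\ \forall b\in A_j\,\forall c\in A_k\,(r(a\wedge b,c)\Rightarrow @^j_k(h\wedge b,c)).$$ **Typed pcas.** Application is partial, associates to the left and is written by juxtaposition; $t\!\downarrow$ means $t$ is defined; an asserted equation $s=t$ implies that $s,t$ (and all subterms) are defined; $t\succeq s$ means that if $s$ is defined then so is $t$ and $s=t$. A typed pca $(I,\mathcal{A})=(I,(\mathcal{A}_i)_{i\in I})$ consists of a set $I$ with binary operations $*,\Rightarrow$ ($\Rightarrow$ associating to the right), sets $\mathcal{A}_i$, and partial application maps $\mathcal{A}_{i\Rightarrow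 j}\times\mathcal{A}_i\rightharpoonup\mathcal{A}_j$, such that for all $i,j,k$ there exist $\mathsf{k}\in\mathcal{A}_{i\Rightarrow j\Rightarrow i}$, $\mathsf{s}\in\mathcal{A}_{(i\Rightarrow j\Rightarrow k)\Rightarrow(i\Rightarrow j)\Rightarrow i\Rightarrow k}$, $\mathsf{pair}\in\mathcal{A}_{i\Rightarrow j\Rightarrow(i*j)}$, $\mathsf{fst}\in\mathcal{A}_{(i*j)\Rightarrow i}$, $\mathsf{snd}\in\mathcal{A}_{(i*j)\Rightarrow j}$ with $\mathsf{k}xy=x$, $\mathsf{s}xy\!\downarrow$, $\mathsf{s}xyz\succeq xz(yz)$, $\mathsf{fst}(\mathsf{pair}\,x\,y)=x$, $\mathsf{snd}(\mathsf{pair}\,x\,y)=y$ for all appropriately typed $x,y,z$. A typed sub-pca is a family of subsets $\mathcal{A}_{\#,i}\subseteq\mathcal{A}_i$ closed under application (if $a\in\mathcal{A}_{\#,i\Rightarrow j}$, $b\in\mathcal{A}_{\#,i}$ and $ab\!\downarrow$ then $ab\in\mathcal{A}_{\#,j}$) such that all the combinators can be chosen in the subsets. A typed pca together with a typed sub-pca is an inclusion of typed pcas. **Associated uniform preorder.** $(I,\mathcal{A},R(\mathcal{A}_\#))$ has sorts $I$, sets $\mathcal{A}_i$, and $R(\mathcal{A}_\#)_{ij}$ is the set of all subrelations of (graphs of) partial functions $(a\cdot-):\mathcal{A}_i\rightharpoonup\mathcal{A}_j$ with $a\in\mathcal{A}_{\#,i\Rightarrow j}$. *)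

theory Defs
  imports Main
begin

section \<open>Uniform preorders\<close>

text \<open>
  A family of sets indexed by sorts is rendered by a family of subsets of one type of elements.
  Only the values of the fields at sorts in \<open>sorts U\<close> matter.
\<close>

record ('i, 'a) upre =
  sorts :: "'i set"
  carr :: "'i \<Rightarrow> 'a set"
  rels :: "'i \<Rightarrow> 'i \<Rightarrow> ('a \<times> 'a) set set"

text \<open>
  Note that \<^term>\<open>r O s\<close> is the relation written \<open>sr\<close> when relations are composed like functions.
\<close>

definition uniform_preorder :: "('i, 'a) upre \<Rightarrow> bool" where
  "uniform_preorder U \<longleftrightarrow>
     (\<forall>i\<in>sorts U. \<forall>j\<in>sorts U. rels U i j \<subseteq> Pow (carr U i \<times> carr U j)) \<and>
     (\<forall>i\<in>sorts U. \<forall>j\<in>sorts U. \<forall>r\<in>rels U i j. \<forall>s. s \<subseteq> r \<longrightarrow> s \<in> rels U i j) \<and>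
     (\<forall>i\<in>sorts U. Id_on (carr U i) \<in> rels U i i) \<and>
     (\<forall>i\<in>sorts U. \<forall>j\<in>sorts U. \<forall>k\<in>sorts U. \<forall>r\<in>rels U i j. \<forall>s\<in>rels U j k. r O s \<in> rels U i k)"

definition functional_upre :: "('i, 'a) upre \<Rightarrow> bool" where
  "functional_upre U \<longleftrightarrow> (\<forall>i\<in>sorts U. \<forall>j\<in>sorts U. \<forall>r\<in>rels U i j. single_valued r)"

text \<open>Equality of uniform preorders, disregarding the values of the fields at non-sorts.\<close>

definition same_upre :: "('i, 'a) upre \<Rightarrow> ('i, 'a) upre \<Rightarrow> bool" where
  "same_upre U V \<longleftrightarrow>
     sorts U = sorts V \<and>
     (\<forall>i\<in>sorts U. carr U i = carr V i) \<and>
     (\<forall>i\<in>sorts U. \<forall>j\<in>sorts U. rels U i j = rels V i j)"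


section \<open>The locally ordered category of uniform preorders\<close>

type_synonym ('i, 'a, 'j, 'b) upre_map = "('i \<Rightarrow> 'j) \<times> ('i \<Rightarrow> 'a \<Rightarrow> 'b)"

definition monotone_map ::
    "('i, 'a) upre \<Rightarrow> ('j, 'b) upre \<Rightarrow> ('i, 'a, 'j, 'b) upre_map \<Rightarrow> bool" where
  "monotone_map U V = (\<lambda>(u, f).
     (\<forall>i\<in>sorts U. u i \<in> sorts V) \<and>
     (\<forall>i\<in>sorts U. \<forall>a\<in>carr U i. f i a \<in> carr V (u i)) \<and>
     (\<forall>i\<in>sorts U. \<forall>j\<in>sorts U. \<forall>r\<in>rels U i j.
        {(f i a, f j b) | a b. (a, b) \<in> r} \<in> rels V (u i) (u j)))"

definition map_le :: "('i, 'a) upre \<Rightarrow> ('j, 'b) upre \<Rightarrow>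
    ('i, 'a, 'j, 'b) upre_map \<Rightarrow> ('i, 'a, 'j, 'b) upre_map \<Rightarrow> bool" where
  "map_le U V = (\<lambda>(u, f) (v, g).
     \<forall>i\<in>sorts U. {(f i a, g i a) | a. a \<in> carr U i} \<in> rels V (u i) (v i))"

definition id_map :: "('i, 'a, 'i, 'a) upre_map" where
  "id_map = (id, \<lambda>i. id)"

definition comp_map :: "('j, 'b, 'k, 'c) upre_map \<Rightarrow> ('i, 'a, 'j, 'b) upre_map \<Rightarrow>
    ('i, 'a, 'k, 'c) upre_map" where
  "comp_map = (\<lambda>(v, g) (u, f). (v \<circ> u, \<lambda>i. g (u i) \<circ> f i))"

text \<open>\<open>is_right_adjoint U V f g\<close> says that \<open>g : V \<rightarrow> U\<close> is right adjoint to \<open>f : U \<rightarrow> V\<close>.\<close>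

definition is_right_adjoint :: "('i, 'a) upre \<Rightarrow> ('j, 'b) upre \<Rightarrow>
    ('i, 'a, 'j, 'b) upre_map \<Rightarrow> ('j, 'b, 'i, 'a) upre_map \<Rightarrow> bool" where
  "is_right_adjoint U V f g \<longleftrightarrow>
     monotone_map U V f \<and> monotone_map V U g \<and>
     map_le U U id_map (comp_map g f) \<and>
     map_le V V (comp_map f g) id_map"

definition prod_rel :: "('a \<times> 'a) set \<Rightarrow> ('b \<times> 'b) set \<Rightarrow> (('a \<times> 'b) \<times> ('a \<times> 'b)) set" where
  "prod_rel r s = {((a, b), (a', b')) | a b a' b'. (a, a') \<in> r \<and> (b, b') \<in> s}"

definition prod_upre :: "('i, 'a) upre \<Rightarrow> ('j, 'b) upre \<Rightarrow> ('i \<times> 'j, 'a \<times> 'b) upre" where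
  "prod_upre U V = \<lparr>
     sorts = sorts U \<times> sorts V,
     carr = (\<lambda>(i, k). carr U i \<times> carr V k),
     rels = (\<lambda>(i, k) (j, l). {t. \<exists>r\<in>rels U i j. \<exists>s\<in>rels V k l. t \<subseteq> prod_rel r s})\<rparr>"

definition terminal_upre :: "(unit, unit) upre" where
  "terminal_upre = \<lparr>sorts = UNIV, carr = (\<lambda>_. UNIV), rels = (\<lambda>_ _. UNIV)\<rparr>"

definition diag_map :: "('i, 'a, 'i \<times> 'i, 'a \<times> 'a) upre_map" where
  "diag_map = (\<lambda>i. (i, i), \<lambda>i a. (a, a))"

definition bang_map :: "('i, 'a, unit, unit) upre_map" where
  "bang_map = (\<lambda>i. (), \<lambda>i a. ())"


section \<open>Finite and relational completeness\<close>

text \<open>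
  The map \<open>(tms, wdg)\<close> consists of \<open>i * j = tms (i, j)\<close> and \<open>a \<and> b = wdg (i, j) (a, b)\<close> for
  \<open>a\<close>, \<open>b\<close> of sorts \<open>i\<close>, \<open>j\<close>; the map \<open>tm\<close> out of the terminal object is the pair \<open>(1, \<top>)\<close>.
\<close>

definition finite_limits :: "('i, 'a) upre \<Rightarrow>
    ('i \<times> 'i, 'a \<times> 'a, 'i, 'a) upre_map \<Rightarrow> (unit, unit, 'i, 'a) upre_map \<Rightarrow> bool" where
  "finite_limits U meet tm \<longleftrightarrow>
     is_right_adjoint U (prod_upre U U) diag_map meet \<and>
     is_right_adjoint U terminal_upre bang_map tm"

definition finitely_complete :: "('i, 'a) upre \<Rightarrow> bool" where
  "finitely_complete U \<longleftrightarrow> uniform_preorder U \<and> (\<exists>meet tm. finite_limits U meet tm)"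

definition relational_exponents :: "('i, 'a) upre \<Rightarrow> ('i \<times> 'i, 'a \<times> 'a, 'i, 'a) upre_map \<Rightarrow>
    ('i \<Rightarrow> 'i \<Rightarrow> 'i) \<Rightarrow> ('i \<Rightarrow> 'i \<Rightarrow> ('a \<times> 'a) set) \<Rightarrow> bool" where
  "relational_exponents U = (\<lambda>(tms, wdg) imp ev.
     \<forall>j\<in>sorts U. \<forall>k\<in>sorts U.
       imp j k \<in> sorts U \<and>
       ev j k \<in> rels U (tms (imp j k, j)) k \<and>
       (\<forall>i\<in>sorts U. \<forall>r\<in>rels U (tms (i, j)) k. \<exists>r'\<in>rels U i (imp j k).
          \<forall>a\<in>carr U i. \<exists>h\<in>carr U (imp j k). (a, h) \<in> r' \<and>
            (\<forall>b\<in>carr U j. \<forall>c\<in>carr U k.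
               (wdg (i, j) (a, b), c) \<in> r \<longrightarrow> (wdg (imp j k, j) (h, b), c) \<in> ev j k)))"

definition relationally_complete :: "('i, 'a) upre \<Rightarrow> bool" where
  "relationally_complete U \<longleftrightarrow>
     uniform_preorder U \<and>
     (\<exists>meet tm imp ev. finite_limits U meet tm \<and> relational_exponents U meet imp ev)"

text \<open>The explicit form of the two adjunctions.\<close>

lemma finite_limits_iff:
  assumes U: "uniform_preorder U"
  shows "finite_limits U (tms, wdg) (one, tp) \<longleftrightarrow>
    monotone_map (prod_upre U U) U (tms, wdg) \<and>
    (\<forall>i\<in>sorts U. \<forall>j\<in>sorts U.
       {(wdg (i, j) (a, b), a) | a b. a \<in> carr U i \<and> b \<in> carr U j} \<in> rels U (tms (i, j)) i \<and>
       {(wdg (i, j) (a, b), b) | a b. a \<in> carr U i \<and> b \<in> carr U j} \<in> rels U (tms (i, j)) j) \<and>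
    (\<forall>i\<in>sorts U. {(a, wdg (i, i) (a, a)) | a. a \<in> carr U i} \<in> rels U i (tms (i, i))) \<and>
    one () \<in> sorts U \<and> tp () () \<in> carr U (one ()) \<and>
    (\<forall>i\<in>sorts U. {(a, tp () ()) | a. a \<in> carr U i} \<in> rels U i (one ()))"
  (is "?L \<longleftrightarrow> ?R")
proof
  assume L: ?L
  then have m: "monotone_map (prod_upre U U) U (tms, wdg)"
    and t: "monotone_map terminal_upre U (one, tp)"
    and e: "map_le U U id_map (comp_map (tms, wdg) diag_map)"
    and c: "map_le (prod_upre U U) (prod_upre U U) (comp_map diag_map (tms, wdg)) id_map"
    and b: "map_le U U id_map (comp_map (one, tp) bang_map)"
    by (auto simp: finite_limits_def is_right_adjoint_def)
  have "{(wdg (i, j) (a, b), a) | a b. a \<in> carr U i \<and> b \<in> carr U j} \<in> rels U (tms (i, j)) i \<and>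
       {(wdg (i, j) (a, b), b) | a b. a \<in> carr U i \<and> b \<in> carr U j} \<in> rels U (tms (i, j)) j"
    if ij: "i \<in> sorts U" "j \<in> sorts U" for i j
  proof -
    have s: "tms (i, j) \<in> sorts U"
      using m ij by (auto simp: monotone_map_def prod_upre_def)
    obtain r s where r: "r \<in> rels U (tms (i, j)) i" and s': "s \<in> rels U (tms (i, j)) j"
      and sub: "{((wdg (i, j) (a, b), wdg (i, j) (a, b)), (a, b)) | a b.
                  a \<in> carr U i \<and> b \<in> carr U j} \<subseteq> prod_rel r s"
      using c ij by (fastforce simp: map_le_def comp_map_def diag_map_def id_map_def prod_upre_def)
    have "{(wdg (i, j) (a, b), a) | a b. a \<in> carr U i \<and> b \<in> carr U j} \<subseteq> r"
      and "{(wdg (i, j) (a, b), b) | a b. a \<in> carr U i \<and> b \<in> carr U j} \<subseteq> s"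
      using sub by (auto simp: prod_rel_def)
    with r s' s ij U show ?thesis
      unfolding uniform_preorder_def by blast
  qed
  with m t e b show ?R
    by (auto simp: monotone_map_def map_le_def comp_map_def diag_map_def bang_map_def id_map_def
        terminal_upre_def)
next
  assume R: ?R
  have down: "s \<in> rels U i j" if "r \<in> rels U i j" "s \<subseteq> r" "i \<in> sorts U" "j \<in> sorts U" for i j r s
    using U that unfolding uniform_preorder_def by blast
  have idr: "Id_on (carr U i) \<in> rels U i i" if "i \<in> sorts U" for i
    using U that unfolding uniform_preorder_def by blast
  have d: "monotone_map U (prod_upre U U) diag_map"
    by (fastforce simp: monotone_map_def prod_upre_def diag_map_def prod_rel_def)
  have c: "map_le (prod_upre U U) (prod_upre U U) (comp_map diag_map (tms, wdg)) id_map"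
  proof -
    have "\<exists>r\<in>rels U (tms (i, j)) i. \<exists>s\<in>rels U (tms (i, j)) j.
        {((wdg (i, j) (a, b), wdg (i, j) (a, b)), (a, b)) | a b. a \<in> carr U i \<and> b \<in> carr U j}
          \<subseteq> prod_rel r s" if ij: "i \<in> sorts U" "j \<in> sorts U" for i j
      using R ij
      by (intro bexI[where x = "{(wdg (i, j) (a, b), a) | a b. a \<in> carr U i \<and> b \<in> carr U j}"]
          bexI[where x = "{(wdg (i, j) (a, b), b) | a b. a \<in> carr U i \<and> b \<in> carr U j}"])
        (auto simp: prod_rel_def)
    then show ?thesis
      by (auto simp: map_le_def comp_map_def diag_map_def id_map_def prod_upre_def)
  qed
  have t: "monotone_map terminal_upre U (one, tp)"
  proof -
    have "{(tp () (), tp () ()) | a b. (a, b) \<in> r} \<in> rels U (one ()) (one ())"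
      for r :: "(unit \<times> unit) set"
      using R by (intro down[OF idr]) auto
    with R show ?thesis
      by (auto simp: monotone_map_def terminal_upre_def)
  qed
  show ?L
    unfolding finite_limits_def is_right_adjoint_def
    using R d c t
    by (auto simp: monotone_map_def map_le_def comp_map_def diag_map_def bang_map_def id_map_def
        terminal_upre_def)
qed


section \<open>Typed partial combinatory algebras\<close>

text \<open>
  The sort \<open>i \<Rightarrow> j\<close> need not determine \<open>i\<close> and \<open>j\<close>, so application carries them as arguments:
  \<open>app T i j\<close> is the partial map from \<open>\<A>\<^bsub>i\<Rightarrow>j\<^esub> \<times> \<A>\<^bsub>i\<^esub>\<close> to \<open>\<A>\<^bsub>j\<^esub>\<close>.
\<close>

record ('i, 'a) tpca =
  psorts :: "'i set"
  prd :: "'i \<Rightarrow> 'i \<Rightarrow> 'i"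
  arr :: "'i \<Rightarrow> 'i \<Rightarrow> 'i"
  pcarr :: "'i \<Rightarrow> 'a set"
  app :: "'i \<Rightarrow> 'i \<Rightarrow> 'a \<Rightarrow> 'a \<Rightarrow> 'a option"

text \<open>Terms denote values in \<^typ>\<open>'a option\<close>, application of terms being strict.\<close>

definition ap :: "('i, 'a) tpca \<Rightarrow> 'i \<Rightarrow> 'i \<Rightarrow> 'a option \<Rightarrow> 'a option \<Rightarrow> 'a option" where
  "ap T i j s t = Option.bind s (\<lambda>f. Option.bind t (app T i j f))"

definition kleene_ge :: "'a option \<Rightarrow> 'a option \<Rightarrow> bool" where
  "kleene_ge t s \<longleftrightarrow> (s \<noteq> None \<longrightarrow> t = s)"

definition is_k :: "('i, 'a) tpca \<Rightarrow> 'i \<Rightarrow> 'i \<Rightarrow> 'a \<Rightarrow> bool" where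
  "is_k T i j k \<longleftrightarrow>
     (\<forall>x\<in>pcarr T i. \<forall>y\<in>pcarr T j.
        ap T j i (ap T i (arr T j i) (Some k) (Some x)) (Some y) = Some x)"

definition is_s :: "('i, 'a) tpca \<Rightarrow> 'i \<Rightarrow> 'i \<Rightarrow> 'i \<Rightarrow> 'a \<Rightarrow> bool" where
  "is_s T i j k s \<longleftrightarrow>
     (\<forall>x\<in>pcarr T (arr T i (arr T j k)). \<forall>y\<in>pcarr T (arr T i j).
        let sxy = ap T (arr T i j) (arr T i k)
                    (ap T (arr T i (arr T j k)) (arr T (arr T i j) (arr T i k)) (Some s) (Some x))
                    (Some y)
        in sxy \<noteq> None \<and>
           (\<forall>z\<in>pcarr T i.
              kleene_ge (ap T i k sxy (Some z))
                (ap T j k (ap T i (arr T j k) (Some x) (Some z)) (ap T i j (Some y) (Some z)))))"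

definition is_pairing :: "('i, 'a) tpca \<Rightarrow> 'i \<Rightarrow> 'i \<Rightarrow> 'a \<Rightarrow> 'a \<Rightarrow> 'a \<Rightarrow> bool" where
  "is_pairing T i j pair p q \<longleftrightarrow>
     (\<forall>x\<in>pcarr T i. \<forall>y\<in>pcarr T j.
        let pxy = ap T j (prd T i j) (ap T i (arr T j (prd T i j)) (Some pair) (Some x)) (Some y)
        in ap T (prd T i j) i (Some p) pxy = Some x \<and>
           ap T (prd T i j) j (Some q) pxy = Some y)"

text \<open>The combinators can be chosen in the subsets \<open>S i\<close>.\<close>

definition has_combinators :: "('i, 'a) tpca \<Rightarrow> ('i \<Rightarrow> 'a set) \<Rightarrow> bool" where
  "has_combinators T S \<longleftrightarrow>
     (\<forall>i\<in>psorts T. \<forall>j\<in>psorts T. \<forall>k\<in>psorts T.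
        (\<exists>kk\<in>S (arr T i (arr T j i)). is_k T i j kk) \<and>
        (\<exists>ss\<in>S (arr T (arr T i (arr T j k)) (arr T (arr T i j) (arr T i k))). is_s T i j k ss) \<and>
        (\<exists>pair\<in>S (arr T i (arr T j (prd T i j))).
           \<exists>p\<in>S (arr T (prd T i j) i). \<exists>q\<in>S (arr T (prd T i j) j).
             is_pairing T i j pair p q))"

definition app_closed :: "('i, 'a) tpca \<Rightarrow> ('i \<Rightarrow> 'a set) \<Rightarrow> bool" where
  "app_closed T S \<longleftrightarrow>
     (\<forall>i\<in>psorts T. \<forall>j\<in>psorts T. \<forall>a\<in>S (arr T i j). \<forall>b\<in>S i. \<forall>c. app T i j a b = Some c \<longrightarrow> c \<in> S j)"

definition typed_pca :: "('i, 'a) tpca \<Rightarrow> bool" where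
  "typed_pca T \<longleftrightarrow>
     (\<forall>i\<in>psorts T. \<forall>j\<in>psorts T. prd T i j \<in> psorts T \<and> arr T i j \<in> psorts T) \<and>
     app_closed T (pcarr T) \<and>
     has_combinators T (pcarr T)"

definition typed_sub_pca :: "('i, 'a) tpca \<Rightarrow> ('i \<Rightarrow> 'a set) \<Rightarrow> bool" where
  "typed_sub_pca T S \<longleftrightarrow>
     (\<forall>i\<in>psorts T. S i \<subseteq> pcarr T i) \<and>
     app_closed T S \<and>
     has_combinators T S"

definition typed_pca_inclusion :: "('i, 'a) tpca \<Rightarrow> ('i \<Rightarrow> 'a set) \<Rightarrow> bool" where
  "typed_pca_inclusion T S \<longleftrightarrow> typed_pca T \<and> typed_sub_pca T S"

definition app_graph :: "('i, 'a) tpca \<Rightarrow> 'i \<Rightarrow> 'i \<Rightarrow> 'a \<Rightarrow> ('a \<times> 'a) set" where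
  "app_graph T i j a = {(b, c). b \<in> pcarr T i \<and> app T i j a b = Some c}"

definition assoc_upre :: "('i, 'a) tpca \<Rightarrow> ('i \<Rightarrow> 'a set) \<Rightarrow> ('i, 'a) upre" where
  "assoc_upre T S = \<lparr>
     sorts = psorts T,
     carr = pcarr T,
     rels = (\<lambda>i j. {r. \<exists>a\<in>S (arr T i j). r \<subseteq> app_graph T i j a})\<rparr>"

end

theory Submission
  imports Defs
begin

text \<open>
  Application is the evaluation relation \<open>@\<close>, which functionality makes a partial map, and the
  sub-pca consists of the \<open>a\<close> with \<open>{(\<top>, a)} \<in> R\<^sub>1\<^sub>i\<close>. Such an \<open>a\<close> names the relation
  \<open>b \<mapsto> @(a \<and> b)\<close>, and conversely a relation in \<open>R\<^sub>i\<^sub>j\<close>, precomposed with the projection from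
  \<open>1 * i\<close>, is curried to a designated element naming it. Since a functional \<open>r\<^sup>~\<close> is a total
  function, the partially applied combinators are defined, and each combinator names a curried
  composite of projections, pairings and evaluations.
\<close>

text \<open>Being a combinator depends on the algebra alone, not on the subset from which the
  element is taken. Combinators found among the designated elements therefore also serve for the
  whole algebra.\<close>

lemma has_combinators_mono:
  assumes S: "has_combinators T S" and sub: "\<And>i. S i \<subseteq> S' i"
  shows "has_combinators T S'"
proof -
  have bex: "\<exists>x\<in>S' i. P x" if "\<exists>x\<in>S i. P x" for i P
    using that sub by blast
  show ?thesis
    unfolding has_combinators_def
  proof (intro ballI conjI)
    fix i j k assume "i \<in> psorts T" "j \<in> psorts T" "k \<in> psorts T"
    note * = S[unfolded has_combinators_def, rule_format, OF this]
    show "\<exists>kk\<in>S' (arr T i (arr T j i)). is_k T i j kk"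
      using * bex by blast
    show "\<exists>ss\<in>S' (arr T (arr T i (arr T j k)) (arr T (arr T i j) (arr T i k))). is_s T i j k ss"
      using * bex by blast
    from * obtain pair p q where "pair \<in> S (arr T i (arr T j (prd T i j)))"
      "p \<in> S (arr T (prd T i j) i)" "q \<in> S (arr T (prd T i j) j)" "is_pairing T i j pair p q"
      by blast
    then show "\<exists>pair\<in>S' (arr T i (arr T j (prd T i j))).
        \<exists>p\<in>S' (arr T (prd T i j) i). \<exists>q\<in>S' (arr T (prd T i j) j). is_pairing T i j pair p q"
      using sub by blast
  qed
qed

text \<open>The adjoints and exponents are fixed as data because the algebra is built from them:
  \<open>tms\<close> and \<open>imp\<close> become its operations on sorts, and \<open>wdg\<close>
  and \<open>ev\<close> yield application.\<close>

locale functional_rel_complete =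
  fixes U :: "('i, 'a) upre"
    and tms :: "'i \<times> 'i \<Rightarrow> 'i" and wdg :: "'i \<times> 'i \<Rightarrow> 'a \<times> 'a \<Rightarrow> 'a"
    and one :: "unit \<Rightarrow> 'i" and tp :: "unit \<Rightarrow> unit \<Rightarrow> 'a"
    and imp :: "'i \<Rightarrow> 'i \<Rightarrow> 'i" and ev :: "'i \<Rightarrow> 'i \<Rightarrow> ('a \<times> 'a) set"
  assumes upre: "uniform_preorder U"
    and functional: "functional_upre U"
    and limits: "finite_limits U (tms, wdg) (one, tp)"
    and exponents: "relational_exponents U (tms, wdg) imp ev"
begin

section \<open>Closure properties of relations and finite products\<close>

lemma rel_sub: "r \<in> rels U i j \<Longrightarrow> s \<subseteq> r \<Longrightarrow> i \<in> sorts U \<Longrightarrow> j \<in> sorts U \<Longrightarrow> s \<in> rels U i j"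
  using upre unfolding uniform_preorder_def by blast

lemma rel_comp:
  "r \<in> rels U i j \<Longrightarrow> s \<in> rels U j k \<Longrightarrow> i \<in> sorts U \<Longrightarrow> j \<in> sorts U \<Longrightarrow> k \<in> sorts U
    \<Longrightarrow> r O s \<in> rels U i k"
  using upre unfolding uniform_preorder_def by blast

lemma rel_Id: "i \<in> sorts U \<Longrightarrow> Id_on (carr U i) \<in> rels U i i"
  using upre unfolding uniform_preorder_def by blast

lemma rel_carr:
  "r \<in> rels U i j \<Longrightarrow> (a, b) \<in> r \<Longrightarrow> i \<in> sorts U \<Longrightarrow> j \<in> sorts U \<Longrightarrow> a \<in> carr U i \<and> b \<in> carr U j"
  using upre[unfolded uniform_preorder_def, THEN conjunct1, rule_format, of i j]
  by (auto dest: subsetD)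

lemma rel_unique:
  "r \<in> rels U i j \<Longrightarrow> (a, b) \<in> r \<Longrightarrow> (a, c) \<in> r \<Longrightarrow> i \<in> sorts U \<Longrightarrow> j \<in> sorts U \<Longrightarrow> b = c"
  using functional[unfolded functional_upre_def, rule_format, of i j r]
  by (auto dest: single_valuedD)

lemmas limits' = limits[unfolded finite_limits_iff[OF upre]]

lemma tms_sort [simp]: "i \<in> sorts U \<Longrightarrow> j \<in> sorts U \<Longrightarrow> tms (i, j) \<in> sorts U"
  using limits' by (auto simp: monotone_map_def prod_upre_def)

lemma wdg_carr [simp]:
  "i \<in> sorts U \<Longrightarrow> j \<in> sorts U \<Longrightarrow> a \<in> carr U i \<Longrightarrow> b \<in> carr U j
    \<Longrightarrow> wdg (i, j) (a, b) \<in> carr U (tms (i, j))"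
  using limits' by (auto simp: monotone_map_def prod_upre_def)

lemma one_sort [simp]: "one () \<in> sorts U" and tp_carr [simp]: "tp () () \<in> carr U (one ())"
  using limits' by auto

lemma rel_fst:
  "i \<in> sorts U \<Longrightarrow> j \<in> sorts U \<Longrightarrow>
    {(wdg (i, j) (a, b), a) | a b. a \<in> carr U i \<and> b \<in> carr U j} \<in> rels U (tms (i, j)) i"
  using limits' by blast

lemma rel_snd:
  "i \<in> sorts U \<Longrightarrow> j \<in> sorts U \<Longrightarrow>
    {(wdg (i, j) (a, b), b) | a b. a \<in> carr U i \<and> b \<in> carr U j} \<in> rels U (tms (i, j)) j"
  using limits' by blast

lemma rel_top: "i \<in> sorts U \<Longrightarrow> {(a, tp () ()) | a. a \<in> carr U i} \<in> rels U i (one ())"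
  using limits' by blast

lemma imp_sort [simp]: "i \<in> sorts U \<Longrightarrow> j \<in> sorts U \<Longrightarrow> imp i j \<in> sorts U"
  and ev_rel: "i \<in> sorts U \<Longrightarrow> j \<in> sorts U \<Longrightarrow> ev i j \<in> rels U (tms (imp i j, i)) j"
  using exponents by (auto simp: relational_exponents_def)

text \<open>This is the universal property of the product on relations: duplicate the argument, then
  use that the meet map is monotone on \<open>r\<close> and \<open>s\<close> acting side by
  side.\<close>

lemma rel_pair:
  assumes r: "r \<in> rels U l i" and s: "s \<in> rels U l j"
    and [simp]: "l \<in> sorts U" "i \<in> sorts U" "j \<in> sorts U"
  shows "{(w, wdg (i, j) (a, b)) | w a b. (w, a) \<in> r \<and> (w, b) \<in> s} \<in> rels U l (tms (i, j))"
proof -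
  let ?D = "{(w, wdg (l, l) (w, w)) | w. w \<in> carr U l}"
  let ?M = "{(wdg (l, l) x, wdg (i, j) y) | x y. (x, y) \<in> prod_rel r s}"
  have "?D \<in> rels U l (tms (l, l))"
    using limits' by simp
  moreover have "?M \<in> rels U (tms (l, l)) (tms (i, j))"
  proof -
    have "prod_rel r s \<in> rels (prod_upre U U) (l, l) (i, j)"
      using r s by (auto simp: prod_upre_def)
    moreover have "(l, l) \<in> sorts (prod_upre U U)" "(i, j) \<in> sorts (prod_upre U U)"
      by (auto simp: prod_upre_def)
    moreover have "monotone_map (prod_upre U U) U (tms, wdg)"
      using limits' by blast
    ultimately show ?thesis
      unfolding monotone_map_def by blast
  qed
  ultimately have "?D O ?M \<in> rels U l (tms (i, j))"
    by (intro rel_comp) auto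
  then show ?thesis
  proof (rule rel_sub)
    show "{(w, wdg (i, j) (a, b)) | w a b. (w, a) \<in> r \<and> (w, b) \<in> s} \<subseteq> ?D O ?M"
    proof clarify
      fix w a b assume "(w, a) \<in> r" "(w, b) \<in> s"
      moreover from this have "w \<in> carr U l"
        using rel_carr[OF r] by simp
      ultimately show "(w, wdg (i, j) (a, b)) \<in> ?D O ?M"
        by (intro relcompI[of _ "wdg (l, l) (w, w)"]) (auto simp: prod_rel_def)
    qed
  qed auto
qed

section \<open>Application and currying\<close>

text \<open>Functionality makes \<open>ev i j\<close> single-valued when \<open>i\<close> and
  \<open>j\<close> are sorts, so the description is unambiguous there; the guard accounts for
  partiality.\<close>

definition apply_opt :: "'i \<Rightarrow> 'i \<Rightarrow> 'a \<Rightarrow> 'a \<Rightarrow> 'a option" where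
  "apply_opt i j f a =
     (if \<exists>c. (wdg (imp i j, i) (f, a), c) \<in> ev i j
      then Some (THE c. (wdg (imp i j, i) (f, a), c) \<in> ev i j) else None)"

lemma apply_opt_eq_Some:
  assumes "i \<in> sorts U" "j \<in> sorts U"
  shows "apply_opt i j f a = Some c \<longleftrightarrow> (wdg (imp i j, i) (f, a), c) \<in> ev i j"
proof -
  have "d = e" if "(wdg (imp i j, i) (f, a), d) \<in> ev i j" "(wdg (imp i j, i) (f, a), e) \<in> ev i j"
    for d e
    using rel_unique[OF ev_rel that] assms by simp
  then show ?thesis
    unfolding apply_opt_def by (auto intro: theI2 the_equality)
qed

lemma apply_opt_carr:
  "apply_opt i j f a = Some c \<Longrightarrow> i \<in> sorts U \<Longrightarrow> j \<in> sorts U \<Longrightarrow> c \<in> carr U j"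
  using rel_carr[OF ev_rel] by (simp add: apply_opt_eq_Some)

text \<open>Pairing \<open>r\<close> with \<open>s\<close> and then evaluating contains this
  relation, so downward closure suffices. Applicative terms in a variable \<open>w\<close> thus
  denote relations.\<close>

lemma rel_apply:
  assumes r: "r \<in> rels U l (imp i j)" and s: "s \<in> rels U l i"
    and [simp]: "l \<in> sorts U" "i \<in> sorts U" "j \<in> sorts U"
  shows "{(w, c) | w f a c. (w, f) \<in> r \<and> (w, a) \<in> s \<and> apply_opt i j f a = Some c} \<in> rels U l j"
    (is "?A \<in> _")
proof -
  have "?A \<subseteq> {(w, wdg (imp i j, i) (f, a)) | w f a. (w, f) \<in> r \<and> (w, a) \<in> s} O ev i j"
    by (auto simp: apply_opt_eq_Some)
  moreover have "\<dots> \<in> rels U l j"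
    by (intro rel_comp[OF rel_pair[OF r s] ev_rel]) auto
  ultimately show ?thesis
    by (blast intro: rel_sub assms)
qed

text \<open>Relational completeness provides a name \<open>h\<close> for every \<open>a\<close>, and
  choosing one gives the total function \<open>t\<close>. Only one direction is claimed: applying
  \<open>t a\<close> may be defined where \<open>r\<close> is not, which matches the passage to
  subrelations and the inequality for \<open>s\<close>.\<close>

lemma curry:
  assumes r: "r \<in> rels U (tms (i, j)) k"
    and [simp]: "i \<in> sorts U" "j \<in> sorts U" "k \<in> sorts U"
  obtains t where "\<And>a. a \<in> carr U i \<Longrightarrow> t a \<in> carr U (imp j k)"
    and "{(a, t a) | a. a \<in> carr U i} \<in> rels U i (imp j k)"
    and "\<And>a b c. a \<in> carr U i \<Longrightarrow> b \<in> carr U j \<Longrightarrow> (wdg (i, j) (a, b), c) \<in> r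
           \<Longrightarrow> apply_opt j k (t a) b = Some c"
proof -
  let ?names = "\<lambda>a h. \<forall>b\<in>carr U j. \<forall>c\<in>carr U k.
      (wdg (i, j) (a, b), c) \<in> r \<longrightarrow> (wdg (imp j k, j) (h, b), c) \<in> ev j k"
  have "\<exists>r'\<in>rels U i (imp j k). \<forall>a\<in>carr U i. \<exists>h\<in>carr U (imp j k). (a, h) \<in> r' \<and> ?names a h"
    using exponents r by (simp add: relational_exponents_def)
  then obtain r' where r': "r' \<in> rels U i (imp j k)"
    and "\<forall>a\<in>carr U i. \<exists>h. h \<in> carr U (imp j k) \<and> (a, h) \<in> r' \<and> ?names a h"
    by (auto simp only: Bex_def)
  from bchoice[OF this(2)] obtain t where
    t: "\<forall>a\<in>carr U i. t a \<in> carr U (imp j k) \<and> (a, t a) \<in> r' \<and> ?names a (t a)"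
    by (rule exE)
  show thesis
  proof (rule that[of t])
    \<comment> \<open>The graph of the choice function lies inside \<open>r'\<close>, so downward
      closure applies.\<close>
    show "{(a, t a) | a. a \<in> carr U i} \<in> rels U i (imp j k)"
      by (rule rel_sub[OF r']) (use t in \<open>blast, simp_all\<close>)
    show "apply_opt j k (t a) b = Some c"
      if "a \<in> carr U i" "b \<in> carr U j" "(wdg (i, j) (a, b), c) \<in> r" for a b c
    proof -
      have "c \<in> carr U k"
        using rel_carr[OF r that(3)] by simp
      then have "(wdg (imp j k, j) (t a, b), c) \<in> ev j k"
        using t that by blast
      then show ?thesis
        by (simp add: apply_opt_eq_Some)
    qed
  qed (use t in blast)
qed

section \<open>Designated elements and the relations they name\<close>

text \<open>These are the global elements. Membership in the carrier is demanded explicitly, so that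
  the inclusion into \<open>carr U\<close> holds at every index, sort or not.\<close>

definition designated :: "'i \<Rightarrow> 'a set" where
  "designated i = {a \<in> carr U i. {(tp () (), a)} \<in> rels U (one ()) i}"

lemma designated_carr: "a \<in> designated i \<Longrightarrow> a \<in> carr U i"
  by (simp add: designated_def)

text \<open>Pointwise application of the two singleton relations out of \<open>one ()\<close> is the
  singleton relation pointing to \<open>c\<close>.\<close>

lemma designated_apply:
  assumes "f \<in> designated (imp i j)" "a \<in> designated i" "apply_opt i j f a = Some c"
    and [simp]: "i \<in> sorts U" "j \<in> sorts U"
  shows "c \<in> designated j"
proof -
  have "{(w, d) | w g b d. (w, g) \<in> {(tp () (), f)} \<and> (w, b) \<in> {(tp () (), a)} \<and>
      apply_opt i j g b = Some d} \<in> rels U (one ()) j"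
    using assms by (intro rel_apply) (auto simp: designated_def)
  also have "{(w, d) | w g b d. (w, g) \<in> {(tp () (), f)} \<and> (w, b) \<in> {(tp () (), a)} \<and>
      apply_opt i j g b = Some d} = {(tp () (), c)}"
    using assms by auto
  finally show ?thesis
    using assms by (auto simp: designated_def intro: apply_opt_carr)
qed

text \<open>The constant relation with value \<open>f\<close> factors through the terminal sort;
  applying it pointwise to the identity gives the relation named by \<open>f\<close>. The condition
  on \<open>b\<close> matters, since \<open>apply_opt\<close> may also be defined outside the
  carrier.\<close>

lemma rel_named:
  assumes f: "f \<in> designated (imp i j)"
    and [simp]: "i \<in> sorts U" "j \<in> sorts U"
  shows "{(b, c). b \<in> carr U i \<and> apply_opt i j f b = Some c} \<in> rels U i j"
proof -
  have "{(a, tp () ()) | a. a \<in> carr U i} O {(tp () (), f)} \<in> rels U i (imp i j)"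
    using f by (intro rel_comp[OF rel_top]) (auto simp: designated_def)
  moreover have "{(a, tp () ()) | a. a \<in> carr U i} O {(tp () (), f)} = {(a, f) | a. a \<in> carr U i}"
    by blast
  ultimately have "{(a, f) | a. a \<in> carr U i} \<in> rels U i (imp i j)"
    by simp
  from rel_apply[OF this rel_Id] show ?thesis
    by (rule rel_sub) auto
qed

text \<open>A dummy argument of sort \<open>one ()\<close> turns \<open>r\<close> into a relation
  that can be curried; the name is the value of the curried function at the top element.\<close>

lemma rel_obtain_name:
  assumes r: "r \<in> rels U i j"
    and [simp]: "i \<in> sorts U" "j \<in> sorts U"
  obtains f where "f \<in> designated (imp i j)"
    and "\<And>b c. (b, c) \<in> r \<Longrightarrow> apply_opt i j f b = Some c"
proof -
  let ?p = "{(wdg (one (), i) (a, b), b) | a b. a \<in> carr U (one ()) \<and> b \<in> carr U i}"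
  have "?p O r \<in> rels U (tms (one (), i)) j"
    by (intro rel_comp[OF rel_snd r]) auto
  then obtain t where t: "\<And>a. a \<in> carr U (one ()) \<Longrightarrow> t a \<in> carr U (imp i j)"
    "{(a, t a) | a. a \<in> carr U (one ())} \<in> rels U (one ()) (imp i j)"
    "\<And>a b c. a \<in> carr U (one ()) \<Longrightarrow> b \<in> carr U i \<Longrightarrow> (wdg (one (), i) (a, b), c) \<in> ?p O r
       \<Longrightarrow> apply_opt i j (t a) b = Some c"
    by (rule curry) auto
  show thesis
  proof (rule that[of "t (tp () ())"])
    have "{(tp () (), t (tp () ()))} \<in> rels U (one ()) (imp i j)"
      by (rule rel_sub[OF t(2)]) auto
    then show "t (tp () ()) \<in> designated (imp i j)"
      using t(1) by (simp add: designated_def)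
    show "apply_opt i j (t (tp () ())) b = Some c" if bc: "(b, c) \<in> r" for b c
    proof (rule t(3))
      show "b \<in> carr U i"
        using rel_carr[OF r bc] by simp
      with bc show "(wdg (one (), i) (tp () (), b), c) \<in> ?p O r"
        by (intro relcompI[of _ b]) auto
    qed simp
  qed
qed

text \<open>After currying, the graph of \<open>t\<close> is itself a relation and has a name. Since
  \<open>t\<close> is total on the carrier, the application of \<open>f\<close> to its first
  argument is always defined.\<close>

lemma obtain_name2:
  assumes r: "r \<in> rels U (tms (i, j)) k"
    and ij: "i \<in> sorts U" "j \<in> sorts U" "k \<in> sorts U"
  obtains f t where "f \<in> designated (imp i (imp j k))"
    and "\<And>a. a \<in> carr U i \<Longrightarrow> apply_opt i (imp j k) f a = Some (t a)"
    and "\<And>a b c. a \<in> carr U i \<Longrightarrow> b \<in> carr U j \<Longrightarrow> (wdg (i, j) (a, b), c) \<in> r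
           \<Longrightarrow> apply_opt j k (t a) b = Some c"
proof -
  obtain t where t: "\<And>a. a \<in> carr U i \<Longrightarrow> t a \<in> carr U (imp j k)"
    "{(a, t a) | a. a \<in> carr U i} \<in> rels U i (imp j k)"
    "\<And>a b c. a \<in> carr U i \<Longrightarrow> b \<in> carr U j \<Longrightarrow> (wdg (i, j) (a, b), c) \<in> r
           \<Longrightarrow> apply_opt j k (t a) b = Some c"
    by (rule curry[OF r ij]) blast
  obtain f where f: "f \<in> designated (imp i (imp j k))"
    "\<And>b c. (b, c) \<in> {(a, t a) | a. a \<in> carr U i} \<Longrightarrow> apply_opt i (imp j k) f b = Some c"
    by (rule rel_obtain_name[OF t(2) ij(1) imp_sort[OF ij(2,3)]]) blast
  show thesis
  proof (rule that)
    show "f \<in> designated (imp i (imp j k))"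
      by (rule f(1))
    show "apply_opt i (imp j k) f a = Some (t a)" if "a \<in> carr U i" for a
      using that by (intro f(2)) simp
  qed (rule t(3))
qed

section \<open>The typed pca and its combinators\<close>

definition pca :: "('i, 'a) tpca" where
  "pca = \<lparr>psorts = sorts U, prd = (\<lambda>i j. tms (i, j)), arr = imp, pcarr = carr U, app = apply_opt\<rparr>"

lemma pca_simps [simp]:
  "psorts pca = sorts U" "prd pca i j = tms (i, j)" "arr pca = imp" "pcarr pca = carr U"
  "app pca = apply_opt"
  by (simp_all add: pca_def)

text \<open>\<open>k\<close> is the two-argument name of the first projection.\<close>

lemma k_exists:
  assumes "i \<in> sorts U" "j \<in> sorts U"
  shows "\<exists>k\<in>designated (imp i (imp j i)). is_k pca i j k"
proof -
  obtain f t where "f \<in> designated (imp i (imp j i))"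
    "\<And>a. a \<in> carr U i \<Longrightarrow> apply_opt i (imp j i) f a = Some (t a)"
    "\<And>a b c. a \<in> carr U i \<Longrightarrow> b \<in> carr U j \<Longrightarrow>
       (wdg (i, j) (a, b), c) \<in> {(wdg (i, j) (a, b), a) | a b. a \<in> carr U i \<and> b \<in> carr U j}
       \<Longrightarrow> apply_opt j i (t a) b = Some c"
    by (rule obtain_name2[OF rel_fst[OF assms] assms assms(1)]) blast
  moreover from this(3) have "apply_opt j i (t x) y = Some x" if "x \<in> carr U i" "y \<in> carr U j" for x y
    using that by blast
  ultimately show ?thesis
    by (intro bexI[of _ f]) (auto simp: is_k_def ap_def)
qed

text \<open>\<open>pair\<close> is the two-argument name of the identity on the product sort;
  \<open>fst\<close> and \<open>snd\<close> name the projections.\<close>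

lemma pairing_exists:
  assumes ij [simp]: "i \<in> sorts U" "j \<in> sorts U"
  shows "\<exists>f\<in>designated (imp i (imp j (tms (i, j)))).
     \<exists>p\<in>designated (imp (tms (i, j)) i). \<exists>q\<in>designated (imp (tms (i, j)) j). is_pairing pca i j f p q"
proof -
  obtain f t where f: "f \<in> designated (imp i (imp j (tms (i, j))))"
    "\<And>a. a \<in> carr U i \<Longrightarrow> apply_opt i (imp j (tms (i, j))) f a = Some (t a)"
    "\<And>a b c. a \<in> carr U i \<Longrightarrow> b \<in> carr U j \<Longrightarrow>
       (wdg (i, j) (a, b), c) \<in> Id_on (carr U (tms (i, j)))
       \<Longrightarrow> apply_opt j (tms (i, j)) (t a) b = Some c"
    by (rule obtain_name2[OF rel_Id[OF tms_sort[OF ij]] ij tms_sort[OF ij]]) blast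
  obtain p where p: "p \<in> designated (imp (tms (i, j)) i)"
    "\<And>w c. (w, c) \<in> {(wdg (i, j) (a, b), a) | a b. a \<in> carr U i \<and> b \<in> carr U j}
       \<Longrightarrow> apply_opt (tms (i, j)) i p w = Some c"
    by (rule rel_obtain_name[OF rel_fst[OF ij] tms_sort[OF ij] ij(1)]) blast
  obtain q where q: "q \<in> designated (imp (tms (i, j)) j)"
    "\<And>w c. (w, c) \<in> {(wdg (i, j) (a, b), b) | a b. a \<in> carr U i \<and> b \<in> carr U j}
       \<Longrightarrow> apply_opt (tms (i, j)) j q w = Some c"
    by (rule rel_obtain_name[OF rel_snd[OF ij] tms_sort[OF ij] ij(2)]) blast
  have "ap pca (tms (i, j)) i (Some p) (Some (wdg (i, j) (x, y))) = Some x \<and>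
        ap pca (tms (i, j)) j (Some q) (Some (wdg (i, j) (x, y))) = Some y \<and>
        ap pca j (tms (i, j)) (ap pca i (imp j (tms (i, j))) (Some f) (Some x)) (Some y)
          = Some (wdg (i, j) (x, y))"
    if "x \<in> carr U i" "y \<in> carr U j" for x y
  proof -
    let ?w = "wdg (i, j) (x, y)"
    have "apply_opt j (tms (i, j)) (t x) y = Some ?w"
      using that by (intro f(3)) auto
    moreover have "apply_opt (tms (i, j)) i p ?w = Some x"
      using that by (intro p(2)) blast
    moreover have "apply_opt (tms (i, j)) j q ?w = Some y"
      using that by (intro q(2)) blast
    ultimately show ?thesis
      using that f(2) by (simp add: ap_def)
  qed
  then have "is_pairing pca i j f p q"
    by (simp add: is_pairing_def)
  with f p q show ?thesis
    by blast
qed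

text \<open>The term \<open>xz(yz)\<close> is a relation in the variable \<open>((x,y),z)\<close>.
  Currying away \<open>z\<close> gives a function of \<open>(x,y)\<close>, whose graph then receives
  a two-argument name.\<close>

lemma s_exists:
  assumes [simp]: "i \<in> sorts U" "j \<in> sorts U" "k \<in> sorts U"
  shows "\<exists>s\<in>designated (imp (imp i (imp j k)) (imp (imp i j) (imp i k))). is_s pca i j k s"
proof -
  let ?X = "imp i (imp j k)" and ?Y = "imp i j"
  let ?XY = "tms (?X, ?Y)"
  let ?W = "tms (?XY, i)"
  \<comment> \<open>\<open>?p\<close> forgets \<open>z\<close>; \<open>?x\<close>,
    \<open>?y\<close>, \<open>?z\<close> then read off the three variables from an element of sort
    \<open>?W\<close>.\<close>
  let ?p = "{(wdg (?XY, i) (a, b), a) | a b. a \<in> carr U ?XY \<and> b \<in> carr U i}"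
  let ?x = "?p O {(wdg (?X, ?Y) (a, b), a) | a b. a \<in> carr U ?X \<and> b \<in> carr U ?Y}"
  let ?y = "?p O {(wdg (?X, ?Y) (a, b), b) | a b. a \<in> carr U ?X \<and> b \<in> carr U ?Y}"
  let ?z = "{(wdg (?XY, i) (a, b), b) | a b. a \<in> carr U ?XY \<and> b \<in> carr U i}"
  have x: "?x \<in> rels U ?W ?X" and y: "?y \<in> rels U ?W ?Y" and z: "?z \<in> rels U ?W i"
    by (auto intro!: rel_comp[OF rel_fst] rel_fst rel_snd)
  \<comment> \<open>Pointwise application builds \<open>xz\<close>, \<open>yz\<close> and finally
    \<open>?v\<close>, the relation from \<open>((x,y),z)\<close> to \<open>xz(yz)\<close>.\<close>
  let ?xz = "{(w, c) | w f a c. (w, f) \<in> ?x \<and> (w, a) \<in> ?z \<and> apply_opt i (imp j k) f a = Some c}"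
  let ?yz = "{(w, c) | w f a c. (w, f) \<in> ?y \<and> (w, a) \<in> ?z \<and> apply_opt i j f a = Some c}"
  let ?v = "{(w, c) | w f a c. (w, f) \<in> ?xz \<and> (w, a) \<in> ?yz \<and> apply_opt j k f a = Some c}"
  have "?v \<in> rels U ?W k"
    by (intro rel_apply[OF rel_apply[OF x z] rel_apply[OF y z]]) auto
  then obtain t where t: "\<And>a. a \<in> carr U ?XY \<Longrightarrow> t a \<in> carr U (imp i k)"
    "{(a, t a) | a. a \<in> carr U ?XY} \<in> rels U ?XY (imp i k)"
    "\<And>a b c. a \<in> carr U ?XY \<Longrightarrow> b \<in> carr U i \<Longrightarrow> (wdg (?XY, i) (a, b), c) \<in> ?v
       \<Longrightarrow> apply_opt i k (t a) b = Some c"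
    by (rule curry) (blast intro: tms_sort imp_sort assms)+
  from t(2) obtain f u where f: "f \<in> designated (imp ?X (imp ?Y (imp i k)))"
    "\<And>a. a \<in> carr U ?X \<Longrightarrow> apply_opt ?X (imp ?Y (imp i k)) f a = Some (u a)"
    "\<And>a b c. a \<in> carr U ?X \<Longrightarrow> b \<in> carr U ?Y \<Longrightarrow>
       (wdg (?X, ?Y) (a, b), c) \<in> {(a, t a) | a. a \<in> carr U ?XY}
       \<Longrightarrow> apply_opt ?Y (imp i k) (u a) b = Some c"
    by (rule obtain_name2) auto
  \<comment> \<open>\<open>sxy\<close> is the value of the total function \<open>t\<close> at the
    pair of \<open>x\<close> and \<open>y\<close>, so it is defined even if \<open>xz(yz)\<close>
    never is.\<close>
  have fxy: "ap pca ?Y (imp i k) (ap pca ?X (imp ?Y (imp i k)) (Some f) (Some x)) (Some y)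
      = Some (t (wdg (?X, ?Y) (x, y)))"
    if "x \<in> carr U ?X" "y \<in> carr U ?Y" for x y
    using that f(2)[of x] f(3)[of x y] by (auto simp: ap_def)
  \<comment> \<open>If \<open>xz(yz)\<close> has value \<open>c\<close>, then \<open>?v\<close>
    relates the nested pair to \<open>c\<close>, and currying makes \<open>sxyz\<close> equal to
    \<open>c\<close>.\<close>
  have fxyz: "ap pca i k (Some (t (wdg (?X, ?Y) (x, y)))) (Some z) = Some c"
    if xyz: "x \<in> carr U ?X" "y \<in> carr U ?Y" "z \<in> carr U i"
      and c: "ap pca j k (ap pca i (imp j k) (Some x) (Some z)) (ap pca i j (Some y) (Some z)) = Some c"
    for x y z c
  proof -
    let ?w = "wdg (?XY, i) (wdg (?X, ?Y) (x, y), z)"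
    from c obtain g b where g: "apply_opt i (imp j k) x z = Some g"
      and b: "apply_opt i j y z = Some b" and gb: "apply_opt j k g b = Some c"
      by (auto simp: ap_def bind_eq_Some_conv)
    have p: "(?w, wdg (?X, ?Y) (x, y)) \<in> ?p" and z: "(?w, z) \<in> ?z"
      using xyz by auto
    have "(?w, x) \<in> ?x" "(?w, y) \<in> ?y"
      by (rule relcompI[OF p]; use xyz in blast)+
    with z g b have "(?w, g) \<in> ?xz" "(?w, b) \<in> ?yz"
      by blast+
    with gb have "(?w, c) \<in> ?v"
      by blast
    with xyz show ?thesis
      by (simp add: ap_def t(3))
  qed
  have "is_s pca i j k f"
    by (auto simp: is_s_def Let_def fxy kleene_ge_def fxyz)
  with f(1) show ?thesis
    by blast
qed

section \<open>The inclusion of typed pcas and its uniform preorder\<close>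

lemma typed_pca_inclusion_pca: "typed_pca_inclusion pca designated"
proof -
  have c: "has_combinators pca designated"
    unfolding has_combinators_def pca_simps by (intro ballI conjI k_exists s_exists pairing_exists)
  then have "has_combinators pca (carr U)"
    by (rule has_combinators_mono) (auto intro: designated_carr)
  then show ?thesis
    using c by (simp add: typed_pca_inclusion_def typed_pca_def typed_sub_pca_def app_closed_def
        designated_carr subsetI, blast intro: apply_opt_carr designated_apply)
qed

text \<open>Every relation is contained in the graph of a designated element by
  \<open>rel_obtain_name\<close>. Conversely such graphs are relations by \<open>rel_named\<close>,
  and so are their subrelations.\<close>

lemma same_upre_pca: "same_upre U (assoc_upre pca designated)"
proof -
  have "r \<in> rels U i j \<longleftrightarrow> (\<exists>a\<in>designated (imp i j). r \<subseteq> app_graph pca i j a)"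
    if ij: "i \<in> sorts U" "j \<in> sorts U" for i j r
  proof
    assume r: "r \<in> rels U i j"
    then obtain f where "f \<in> designated (imp i j)"
      "\<And>b c. (b, c) \<in> r \<Longrightarrow> apply_opt i j f b = Some c"
      by (rule rel_obtain_name) (use ij in auto)
    with rel_carr[OF r] ij show "\<exists>a\<in>designated (imp i j). r \<subseteq> app_graph pca i j a"
      by (intro bexI[of _ f]) (auto simp: app_graph_def)
  next
    assume "\<exists>a\<in>designated (imp i j). r \<subseteq> app_graph pca i j a"
    with rel_named ij show "r \<in> rels U i j"
      by (auto simp: app_graph_def intro: rel_sub)
  qed
  then show ?thesis
    by (auto simp: same_upre_def assoc_upre_def)
qed

end

theorem lemma4p10p6:
  fixes U :: "('i, 'a) upre"
  assumes "uniform_preorder U"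
    and "relationally_complete U"
    and "functional_upre U"
  shows "\<exists>(T :: ('i, 'a) tpca) (S :: 'i \<Rightarrow> 'a set).
           typed_pca_inclusion T S \<and> same_upre U (assoc_upre T S)"
proof -
  from assms(2) obtain meet tm imp ev where "finite_limits U meet tm"
    "relational_exponents U meet imp ev"
    unfolding relationally_complete_def by blast
  moreover obtain tms wdg one tp where "meet = (tms, wdg)" "tm = (one, tp)"
    by (cases meet, cases tm)
  ultimately have "finite_limits U (tms, wdg) (one, tp)" "relational_exponents U (tms, wdg) imp ev"
    by simp_all
  with assms interpret functional_rel_complete U tms wdg one tp imp ev
    by unfold_locales
  show ?thesis
    using typed_pca_inclusion_pca same_upre_pca by blast
qed

end
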